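(* Let $n \ge 1$ be an integer and let $A:[0,1]\to GL(n,\mathbb{C})$ be a continuous function with $A(0)=A(1)$. Let $\operatorname{wn}(A)\in\mathbb{Z}$ denote the winding number around the origin of the closed path $t\mapsto \det A(t)$ in $\mathbb{C}\setminus\{0\}$. If $n \nmid \operatorname{wn}(A)$, then there exists $\phi\in[0,1]$ such that $$0 \in \operatorname{conv}\boldsymbol{\lambda}(A(\phi)) \subseteq W(A(\phi)),$$ where $\operatorname{conv}\boldsymbol{\lambda}(A(\phi))$ is the convex hull in $\mathbb{C}$ of all the eigenvalues of $A(\phi)$ and $W(A(\phi))$ is the numerical range of $A(\phi)$.
   Context: For an $n\times n$ complex matrix $M$, the numerical range of $M$ is $W(M) = \{x^{*}Mx : x\in\mathbb{C}^n,\ x^{*}x=1\}\subseteq\mathbb{C}$, where $x^*$ is the conjugate transpose of $x$. The set $\operatorname{conv}\boldsymbol{\lambda}(M)\subseteq\mathbb{C}$ is the convex hull of all the (complex) eigenvalues of $M$. Winding number of a path: for a continuous path $\gamma:[0,1]\to\mathbb{C}\setminus\{0\}$ with $\gamma(0)=\gamma(1)$, write $\gamma(t)=\rho(t)e^{i2\pi s(t)}$ with $\rho:[0,1]\to\mathbb{R}^{+}=(0,\infty)$ and $s:[0,1]\to\mathbb{R}$ continuous (i.e. $(\rho,s)$ is a lift of $\gamma$ through the covering map $\mathbb{R}^{+}\times\mathbb{R}\to\mathbb{C}\setminus\{0\}$, $(\rho_0,s_0)\mapsto\rho_0e^{i2\pi s_0}$). The winding number of $\gamma$ around the origin is $\operatorname{wn}(\gamma)=s(1)-s(0)\in\mathbb{Z}$.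 Winding number of a loop of matrices: for a continuous $A:[0,1]\to GL(n,\mathbb{C})$ with $A(0)=A(1)$, $\operatorname{wn}(A)$ is defined as $\operatorname{wn}(\det A)$, the winding number around the origin of $t\mapsto\det A(t)$. *)

theory Defs
  imports "HOL-Complex_Analysis.Complex_Analysis"
begin

unbundle no fps_syntax

subsection \<open>Eigenvalues and the numerical range of a complex square matrix\<close>

definition eigenvalues :: "complex ^ 'n ^ 'n \<Rightarrow> complex set" where
  "eigenvalues M = {\<mu>. \<exists>x. x \<noteq> 0 \<and> M *v x = \<mu> *s x}"

text \<open>
  The product \<open>x\<^sup>* y\<close>, conjugate-linear in \<open>x\<close>; the library operation \<open>\<bullet>\<close> on
  \<open>complex ^ 'n\<close> is only the real inner product.
\<close>

definition cinner_vec :: "complex ^ 'n \<Rightarrow> complex ^ 'n \<Rightarrow> complex" where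
  "cinner_vec x y = (\<Sum>i\<in>UNIV. cnj (x $ i) * y $ i)"

definition numerical_range :: "complex ^ 'n ^ 'n \<Rightarrow> complex set" where
  "numerical_range M = {cinner_vec x (M *v x) | x. cinner_vec x x = 1}"


subsection \<open>Winding number around the origin\<close>

definition polar_lift :: "(real \<Rightarrow> complex) \<Rightarrow> (real \<Rightarrow> real) \<Rightarrow> (real \<Rightarrow> real) \<Rightarrow> bool" where
  "polar_lift \<gamma> \<rho> s \<longleftrightarrow>
     continuous_on {0..1} \<rho> \<and> continuous_on {0..1} s \<and>
     (\<forall>t\<in>{0..1}. \<rho> t > 0 \<and>
        \<gamma> t = complex_of_real (\<rho> t) * exp (\<i> * complex_of_real (2 * pi * s t)))"

text \<open>
  Meaningful only for continuous loops in the punctured plane, where it is shown below to be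
  independent of the lift and to agree with \<open>winding_number \<gamma> 0\<close>.
\<close>

definition wn :: "(real \<Rightarrow> complex) \<Rightarrow> int" where
  "wn \<gamma> = (THE k. \<exists>\<rho> s. polar_lift \<gamma> \<rho> s \<and> s 1 - s 0 = real_of_int k)"

definition wn_matrix :: "(real \<Rightarrow> complex ^ 'n ^ 'n) \<Rightarrow> int" where
  "wn_matrix A = wn (\<lambda>t. det (A t))"

lemma polar_lift_exists:
  assumes "continuous_on {0..1} \<gamma>" "\<And>t. t \<in> {0..1} \<Longrightarrow> \<gamma> t \<noteq> 0"
  obtains \<rho> s where "polar_lift \<gamma> \<rho> s"
proof -
  have "path \<gamma>" "0 \<notin> path_image \<gamma>"
    using assms by (auto simp: path_def path_image_def)
  then obtain q where q: "path q" and eq: "\<And>t. t \<in> {0..1} \<Longrightarrow> \<gamma> t = 0 + exp (q t)"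
    by (rule winding_number_as_continuous_log) blast
  have "polar_lift \<gamma> (\<lambda>t. exp (Re (q t))) (\<lambda>t. Im (q t) / (2 * pi))"
    unfolding polar_lift_def
  proof (intro conjI ballI)
    show "continuous_on {0..1} (\<lambda>t. exp (Re (q t)))"
      and "continuous_on {0..1} (\<lambda>t. Im (q t) / (2 * pi))"
      using q unfolding path_def by (auto intro!: continuous_intros)
    show "\<gamma> t = complex_of_real (exp (Re (q t))) *
        exp (\<i> * complex_of_real (2 * pi * (Im (q t) / (2 * pi))))" if "t \<in> {0..1}" for t
      using eq[OF that] exp_eq_polar[of "q t"] by (simp add: cis_conv_exp)
  qed simp
  then show ?thesis by (rule that)
qed

lemma polar_lift_winding_number:
  assumes "polar_lift \<gamma> \<rho> s" "\<gamma> 0 = \<gamma> 1"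
  shows "winding_number \<gamma> 0 = complex_of_real (s 1 - s 0)"
proof -
  define q where "q t = complex_of_real (ln (\<rho> t)) + \<i> * complex_of_real (2 * pi * s t)" for t
  have cont: "continuous_on {0..1} \<rho>" "continuous_on {0..1} s"
    and pos: "\<And>t. t \<in> {0..1} \<Longrightarrow> \<rho> t > 0"
    and eq: "\<And>t. t \<in> {0..1} \<Longrightarrow>
      \<gamma> t = complex_of_real (\<rho> t) * exp (\<i> * complex_of_real (2 * pi * s t))"
    using assms(1) by (auto simp: polar_lift_def)
  have "path q"
    unfolding path_def q_def using cont pos by (force intro!: continuous_intros)
  have norm: "norm (\<gamma> t) = \<rho> t" if "t \<in> {0..1}" for t
    using eq[OF that] pos[OF that] by (simp add: norm_mult)
  have "\<rho> 0 = \<rho> 1"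
    using norm[of 0] norm[of 1] assms(2) by simp
  have exp_q: "\<gamma> t = (exp \<circ> q) t" if "t \<in> {0..1}" for t
    using eq[OF that] pos[OF that] by (simp add: q_def exp_add exp_of_real)
  have "winding_number \<gamma> 0 = winding_number (exp \<circ> q) 0"
    using exp_q by (intro winding_number_cong) auto
  also have "\<dots> = (pathfinish q - pathstart q) / (2 * of_real pi * \<i>)"
    using \<open>path q\<close> by (rule winding_number_compose_exp)
  also have "\<dots> = complex_of_real (s 1 - s 0)"
    using \<open>\<rho> 0 = \<rho> 1\<close> by (simp add: q_def pathfinish_def pathstart_def field_simps)
  finally show ?thesis .
qed

lemma
  assumes "continuous_on {0..1} \<gamma>" "\<And>t. t \<in> {0..1} \<Longrightarrow> \<gamma> t \<noteq> 0" "\<gamma> 0 = \<gamma> 1"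
  shows wn_eq_winding_number: "complex_of_int (wn \<gamma>) = winding_number \<gamma> 0"
    and wn_eq_lift: "polar_lift \<gamma> \<rho> s \<Longrightarrow> real_of_int (wn \<gamma>) = s 1 - s 0"
proof -
  have "winding_number \<gamma> 0 \<in> \<int>"
    using assms by (intro integer_winding_number)
      (auto simp: path_def path_image_def pathfinish_def pathstart_def)
  then obtain k where k: "winding_number \<gamma> 0 = complex_of_int k"
    by (auto elim: Ints_cases)
  have lift: "s 1 - s 0 = real_of_int k" if "polar_lift \<gamma> \<rho> s" for \<rho> s
    using polar_lift_winding_number[OF that assms(3)] k
    by (metis of_real_eq_iff of_real_of_int_eq)
  obtain \<rho>' s' where lift': "polar_lift \<gamma> \<rho>' s'"
    using polar_lift_exists[OF assms(1,2)] by blast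
  have "wn \<gamma> = k"
    unfolding wn_def
  proof (rule the_equality)
    show "\<exists>\<rho> s. polar_lift \<gamma> \<rho> s \<and> s 1 - s 0 = real_of_int k"
      using lift lift' by blast
  next
    fix m assume "\<exists>\<rho> s. polar_lift \<gamma> \<rho> s \<and> s 1 - s 0 = real_of_int m"
    then show "m = k" using lift by fastforce
  qed
  then show "complex_of_int (wn \<gamma>) = winding_number \<gamma> 0"
    and "polar_lift \<gamma> \<rho> s \<Longrightarrow> real_of_int (wn \<gamma>) = s 1 - s 0"
    using k lift by auto
qed

end

theory Submission
  imports
    Defs
    "HOL-Computational_Algebra.Fundamental_Theorem_Algebra"
begin

text \<open>
  The inclusion holds for every matrix: an eigenvalue is the Rayleigh quotient of its eigenvector, and
  the numerical range is convex by the Toeplitz--Hausdorff theorem (\<open>convex_numerical_range\<close>).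

  For the existence of \<open>\<phi>\<close>, suppose that no convex hull of the eigenvalues of \<open>A(t)\<close> contains \<open>0\<close>.
  Contract all eigenvalues of \<open>A(t)\<close> to their mean \<open>c(t) = tr A(t) / n\<close> by the homotopy
  \<open>(1 - s) A(t) + s c(t) I\<close>. The mean lies in the convex hull
  (\<open>mean_in_convex_hull_eigenvalues\<close>), so the eigenvalues never leave the hull during the
  contraction. In particular they stay away from \<open>0\<close>, so the determinant does too
  (\<open>det_contraction_nonzero\<close>). Unlike the single eigenvalues, the trace depends continuously on \<open>t\<close>
  without any choice of branches, so this is a homotopy of loops in the punctured plane from
  \<open>det A(t)\<close> to \<open>c(t)\<^sup>n\<close>. Hence the winding number of \<open>A\<close> is \<open>n\<close> times that of \<open>c\<close>
  (\<open>wn_power\<close>), and \<open>n\<close> divides it.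
\<close>

\<comment> \<open>The symbol \<open>$\<close> should denote vector components only, not also coefficients of power series.\<close>
unbundle no Formal_Power_Series.fps_syntax

section \<open>The numerical range is convex\<close>

lemma cinner_vec_add_left: "cinner_vec (x + y) z = cinner_vec x z + cinner_vec y z"
  by (simp add: cinner_vec_def sum.distrib algebra_simps)

lemma cinner_vec_add_right: "cinner_vec x (y + z) = cinner_vec x y + cinner_vec x z"
  by (simp add: cinner_vec_def sum.distrib algebra_simps)

lemma cinner_vec_scale_left: "cinner_vec (c *s x) y = cnj c * cinner_vec x y"
  by (simp add: cinner_vec_def sum_distrib_left algebra_simps)

lemma cinner_vec_scale_right: "cinner_vec x (c *s y) = c * cinner_vec x y"
  by (simp add: cinner_vec_def sum_distrib_left algebra_simps)

lemmas cinner_vec_sesquilinear =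
  cinner_vec_add_left cinner_vec_add_right cinner_vec_scale_left cinner_vec_scale_right

lemma cinner_vec_self: "cinner_vec x x = complex_of_real ((norm x)\<^sup>2)"
proof -
  have "(norm x)\<^sup>2 = (\<Sum>i\<in>UNIV. (norm (x $ i))\<^sup>2)"
    by (simp add: norm_vec_def L2_set_def sum_nonneg)
  then show ?thesis
    by (simp add: cinner_vec_def complex_norm_square mult.commute del: of_real_power)
qed

lemma rayleigh_quotient_in_numerical_range:
  fixes x :: "complex ^ 'n"
  assumes "x \<noteq> 0"
  shows "cinner_vec x (M *v x) / cinner_vec x x \<in> numerical_range M"
proof -
  define k where "k = complex_of_real (inverse (norm x))"
  have k: "cnj k * k * cinner_vec x x = 1"
    using assms by (simp add: k_def cinner_vec_self power2_eq_square field_simps)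
  have "cinner_vec (k *s x) (k *s x) = 1"
    using k by (simp add: cinner_vec_sesquilinear mult_ac)
  moreover have "cinner_vec (k *s x) (M *v (k *s x)) = cinner_vec x (M *v x) / cinner_vec x x"
  proof -
    have "cinner_vec (k *s x) (M *v (k *s x)) = (cnj k * k) * cinner_vec x (M *v x)"
      by (simp add: vec.scale cinner_vec_sesquilinear mult_ac)
    also have "cnj k * k = 1 / cinner_vec x x"
      using k by (metis divide_eq_eq mult_zero_right zero_neq_one nonzero_eq_divide_eq)
    finally show ?thesis by simp
  qed
  ultimately show ?thesis
    unfolding numerical_range_def mem_Collect_eq by metis
qed

text \<open>
  This is the Toeplitz--Hausdorff theorem. Given two distinct values \<open>a\<close> and \<open>b\<close> of the form on unit
  vectors \<open>x\<close> and \<open>y\<close>, an affine change of the form makes these values \<open>0\<close> and \<open>1\<close>. After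
  multiplying \<open>x\<close> by a suitable phase, the new form \<open>g\<close> is real on the real segment from \<open>x\<close> to \<open>y\<close>,
  and this segment avoids the origin. The normalized values of \<open>g\<close> along the segment are then a
  continuous real function running from \<open>0\<close> to \<open>1\<close>, so they take every intermediate value.
\<close>

theorem convex_numerical_range:
  fixes M :: "complex ^ 'n ^ 'n"
  shows "convex (numerical_range M)"
proof (rule convexI)
  fix a b :: complex and u v :: real
  assume a: "a \<in> numerical_range M" and b: "b \<in> numerical_range M"
    and uv: "0 \<le> u" "0 \<le> v" "u + v = 1"
  show "u *\<^sub>R a + v *\<^sub>R b \<in> numerical_range M"
  proof (cases "a = b")
    case True
    then show ?thesis using a uv by (simp flip: scaleR_add_left)
  next
    case False
    obtain x where x: "a = cinner_vec x (M *v x)" "cinner_vec x x = 1"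
      using a by (auto simp: numerical_range_def)
    obtain y where y: "b = cinner_vec y (M *v y)" "cinner_vec y y = 1"
      using b by (auto simp: numerical_range_def)
    define g where "g z w = (cinner_vec z (M *v w) - a * cinner_vec z w) / (b - a)" for z w
    have gxx: "g x x = 0" and gyy: "g y y = 1"
      using x y False by (simp_all add: g_def)
    have g_expand: "g (c *s x + d *s y) (c *s x + d *s y) =
        cnj c * d * g x y + cnj d * c * g y x + cnj d * d" for c d
    proof -
      have "g (c *s x + d *s y) (c *s x + d *s y) =
          cnj c * c * g x x + cnj c * d * g x y + cnj d * c * g y x + cnj d * d * g y y"
        by (simp add: g_def vec.add vec.scale cinner_vec_sesquilinear
            add_divide_distrib diff_divide_distrib algebra_simps)
      then show ?thesis by (simp add: gxx gyy)
    qed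
    define p where "p = g x y"
    define q where "q = g y x"
    \<comment> \<open>The cross terms of \<open>g\<close> at \<open>(1 - t) w x + t y\<close> add up to a multiple of \<open>cnj w * p + w * q\<close>; for \<open>w\<close>
      proportional to \<open>p - cnj q\<close> this number is proportional to \<open>(norm p)\<^sup>2 - (norm q)\<^sup>2\<close>.\<close>
    define w where "w = (if p = cnj q then 1 else sgn (p - cnj q))"
    have w0: "w \<noteq> 0"
      by (auto simp: w_def sgn_zero_iff)
    have "cnj w * p + w * q \<in> \<real>"
    proof (cases "p = cnj q")
      case True
      then show ?thesis by (simp add: w_def complex_is_Real_iff)
    next
      case False
      have "cnj w * p + w * q = (cnj (p - cnj q) * p + (p - cnj q) * q) / cmod (p - cnj q)"
        using False by (simp add: w_def sgn_div_norm scaleR_conv_of_real divide_inverse algebra_simps)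
      moreover have "cnj (p - cnj q) * p + (p - cnj q) * q = p * cnj p - q * cnj q"
        by (simp add: algebra_simps)
      ultimately show ?thesis
        by (simp add: complex_is_Real_iff flip: complex_norm_square)
    qed
    then obtain r where r: "cnj w * p + w * q = complex_of_real r"
      by (auto elim: Reals_cases)
    define z where "z t = (complex_of_real (1 - t) * w) *s x + complex_of_real t *s y" for t
    have gz: "g (z t) (z t) = complex_of_real ((1 - t) * t * r + t\<^sup>2)" for t
    proof -
      have "g (z t) (z t) = complex_of_real ((1 - t) * t) * (cnj w * p + w * q) + complex_of_real (t\<^sup>2)"
        unfolding z_def g_expand p_def q_def by (simp add: power2_eq_square algebra_simps)
      then show ?thesis by (simp add: r)
    qed
    have z_nz: "z t \<noteq> 0" for t
    proof
      assume z0: "z t = 0"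
      show False
      proof (cases "t = 0")
        case True
        then have "x = 0" using z0 w0 by (simp add: z_def)
        then show False using x(2) by (simp add: cinner_vec_def)
      next
        case False
        \<comment> \<open>Here \<open>y\<close> would be a multiple of \<open>x\<close>, and \<open>g\<close> would vanish on \<open>y\<close> as it does on \<open>x\<close>.\<close>
        define k where "k = - (complex_of_real (1 - t) * w) / complex_of_real t"
        have "y = k *s x"
          using z0 False by (simp add: z_def k_def vec_eq_iff field_simps add_eq_0_iff)
        then have "g y y = cnj k * k * g x x"
          by (simp add: g_def vec.scale cinner_vec_sesquilinear algebra_simps diff_divide_distrib)
        then show False using gxx gyy by simp
      qed
    qed
    define h where "h t = ((1 - t) * t * r + t\<^sup>2) / (norm (z t))\<^sup>2" for t
    have "continuous_on {0..1} z"
      unfolding z_def vector_scalar_mult_def by (intro continuous_intros)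
    then have "continuous_on {0..1} h"
      unfolding h_def using z_nz by (intro continuous_intros) auto
    moreover have "h 0 = 0" by (simp add: h_def)
    moreover have "h 1 = 1"
    proof -
      have "(norm y)\<^sup>2 = 1"
        using y(2) by (metis cinner_vec_self of_real_eq_1_iff)
      then show ?thesis by (simp add: h_def z_def)
    qed
    ultimately obtain t where t: "h t = v"
      using IVT'[of h 0 v 1] uv by auto
    have nz: "cinner_vec (z t) (z t) \<noteq> 0"
      using z_nz by (simp add: cinner_vec_self)
    have "cinner_vec (z t) (M *v z t) = a * cinner_vec (z t) (z t) + (b - a) * g (z t) (z t)"
      using False by (simp add: g_def)
    then have "cinner_vec (z t) (M *v z t) / cinner_vec (z t) (z t) =
        a + (b - a) * (g (z t) (z t) / cinner_vec (z t) (z t))"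
      using nz by (simp add: add_divide_distrib)
    also have "g (z t) (z t) / cinner_vec (z t) (z t) = complex_of_real v"
      using t unfolding gz h_def cinner_vec_self by (metis of_real_divide)
    also have "a + (b - a) * complex_of_real v = u *\<^sub>R a + v *\<^sub>R b"
    proof -
      have u: "u = 1 - v" using uv(3) by simp
      show ?thesis unfolding u by (simp add: scaleR_conv_of_real algebra_simps)
    qed
    finally show ?thesis
      using rayleigh_quotient_in_numerical_range[OF z_nz[of t], of M] by simp
  qed
qed

corollary convex_hull_eigenvalues_subset_numerical_range:
  fixes M :: "complex ^ 'n ^ 'n"
  shows "convex hull eigenvalues M \<subseteq> numerical_range M"
proof (rule hull_minimal[of _ _ convex, OF _ convex_numerical_range], rule subsetI)
  fix \<mu> assume "\<mu> \<in> eigenvalues M"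
  then obtain x where x: "x \<noteq> 0" "M *v x = \<mu> *s x"
    by (auto simp: eigenvalues_def)
  have "cinner_vec x (M *v x) / cinner_vec x x = \<mu>"
    using x by (simp add: cinner_vec_self cinner_vec_scale_right)
  then show "\<mu> \<in> numerical_range M"
    using rayleigh_quotient_in_numerical_range[OF x(1), of M] by simp
qed


section \<open>The mean of the eigenvalues\<close>

text \<open>
  With \<open>a = -1\<close> this finds the roots of the characteristic polynomial; with \<open>a = 1 - s\<close> it controls
  the determinant along the contraction of the spectrum.
\<close>

lemma eigenvalue_if_det_eq_0:
  fixes M :: "complex ^ 'n ^ 'n"
  assumes "det (a *\<^sub>R M + mat b) = 0" "a \<noteq> 0"
  shows "- b / a \<in> eigenvalues M"
proof -
  obtain x where x: "x \<noteq> 0" "(a *\<^sub>R M + mat b) *v x = 0"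
    using assms(1) by (metis invertible_det_nz invertible_left_inverse matrix_left_invertible_ker)
  have "(mat b *v x) $ i = b * x $ i" for i
    by (simp add: matrix_vector_mult_def mat_def if_distrib[of "\<lambda>c. c * _"] cong: if_cong)
  moreover have "((a *\<^sub>R M) *v x) $ i = of_real a * (M *v x) $ i" for i
    by (simp add: matrix_vector_mult_def sum_distrib_left scaleR_conv_of_real[where 'a = complex] mult.assoc)
  ultimately have "of_real a * (M *v x) $ i + b * x $ i = 0" for i
    using x(2) by (metis matrix_vector_mult_add_rdistrib vector_add_component zero_index)
  then have "M *v x = (- b / a) *s x"
    using assms(2) by (simp add: vec_eq_iff field_simps eq_neg_iff_add_eq_0)
  then show ?thesis
    using x(1) by (auto simp: eigenvalues_def)
qed

definition charpoly :: "'a::comm_ring_1 ^ 'n ^ 'n \<Rightarrow> 'a poly" where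
  "charpoly M = det (\<chi> i j. if i = j then [:- (M $ i $ i), 1:] else [:- (M $ i $ j):])"

lemma poly_charpoly: "poly (charpoly M) x = det (mat x - M)"
proof -
  have "poly (if i = j then [:- (M $ i $ i), 1:] else [:- (M $ i $ j):]) x = (mat x - M) $ i $ j" for i j
    by (simp add: mat_def)
  then show ?thesis
    by (simp add: charpoly_def det_def poly_sum poly_prod)
qed

lemma degree_prod_linear_factors_le:
  fixes f :: "'i \<Rightarrow> 'a::comm_ring_1"
  assumes "finite S"
  shows "degree (\<Prod>i\<in>S. [:- f i, 1:]) \<le> card S"
  using degree_prod_sum_le[OF assms, of "\<lambda>i. [:- f i, 1:]"] by simp

lemma coeff_prod_linear_factors:
  fixes f :: "'i \<Rightarrow> 'a::comm_ring_1"
  assumes "finite S"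
  shows "coeff (\<Prod>i\<in>S. [:- f i, 1:]) (card S) = 1"
    and "S \<noteq> {} \<Longrightarrow> coeff (\<Prod>i\<in>S. [:- f i, 1:]) (card S - 1) = - (\<Sum>i\<in>S. f i)"
proof -
  have lead: "coeff (\<Prod>i\<in>T. [:- f i, 1:]) (card T) = 1" if "finite T" for T
    using that
  proof (induction T rule: finite_induct)
    case (insert a T)
    have "coeff (\<Prod>i\<in>T. [:- f i, 1:]) (Suc (card T)) = 0"
      using degree_prod_linear_factors_le[OF insert.hyps(1), of f] by (intro coeff_eq_0) simp
    then show ?case using insert by simp
  qed simp
  then show "coeff (\<Prod>i\<in>S. [:- f i, 1:]) (card S) = 1"
    using assms by blast
  show "coeff (\<Prod>i\<in>S. [:- f i, 1:]) (card S - 1) = - (\<Sum>i\<in>S. f i)" if "S \<noteq> {}"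
    using assms that
  proof (induction S rule: finite_ne_induct)
    case (insert a S)
    then obtain m where "card S = Suc m"
      by (metis card_0_eq not0_implies_Suc)
    then show ?case
      using insert lead[OF insert.hyps(1)] by simp
  qed simp
qed

text \<open>
  A permutation other than the identity moves at least two indices, so the only term of the Leibniz
  expansion of the characteristic polynomial that reaches degree \<open>n - 1\<close> is the product over the
  diagonal.
\<close>

lemma coeff_charpoly:
  fixes M :: "'a::comm_ring_1 ^ 'n ^ 'n"
  assumes "k \<ge> CARD('n) - 1"
  shows "coeff (charpoly M) k = coeff (\<Prod>i\<in>UNIV. [:- (M $ i $ i), 1:]) k"
proof -
  let ?C = "(\<chi> i j. if i = j then [:- (M $ i $ i), 1:] else [:- (M $ i $ j):]) :: 'a poly ^ 'n ^ 'n"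
  let ?P = "{p. p permutes (UNIV :: 'n set)}"
  let ?t = "\<lambda>p. of_int (sign p) * (\<Prod>i\<in>UNIV. ?C $ i $ p i)"
  have off_diag: "coeff (?t p) k = 0" if p: "p permutes UNIV" "p \<noteq> id" for p
  proof -
    obtain i where i: "p i \<noteq> i"
      using p(2) by (auto simp: fun_eq_iff)
    then have "p (p i) \<noteq> p i"
      using permutes_inj[OF p(1)] by (simp add: inj_eq)
    then have "{j. p j = j} \<subseteq> UNIV - {i, p i}"
      using i by auto
    then have "card {j. p j = j} \<le> card (UNIV - {i, p i})"
      by (intro card_mono) auto
    also have "\<dots> = CARD('n) - 2"
      using i by (subst card_Diff_subset) auto
    finally have fixpoints: "card {j. p j = j} \<le> CARD('n) - 2" .
    have "card {i, p i} \<le> CARD('n)"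
      by (rule card_mono) auto
    then have n2: "CARD('n) \<ge> 2"
      using i by simp
    have "degree (\<Prod>i\<in>UNIV. ?C $ i $ p i) \<le> (\<Sum>i\<in>UNIV. degree (?C $ i $ p i))"
      using degree_prod_sum_le[of UNIV "\<lambda>i. ?C $ i $ p i"] by (simp add: o_def)
    also have "\<dots> = (\<Sum>i\<in>UNIV. if p i = i then 1 else 0)"
      by (rule sum.cong) auto
    also have "\<dots> = card {j. p j = j}"
      by (simp flip: sum.inter_filter)
    finally have "degree (\<Prod>i\<in>UNIV. ?C $ i $ p i) < k"
      using fixpoints n2 assms by linarith
    then have "coeff (\<Prod>i\<in>UNIV. ?C $ i $ p i) k = 0"
      by (rule coeff_eq_0)
    then show ?thesis
      by (simp add: sign_def)
  qed
  have "coeff (charpoly M) k = (\<Sum>p\<in>?P. coeff (?t p) k)"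
    by (simp add: charpoly_def det_def coeff_sum)
  also have "\<dots> = coeff (?t id) k + (\<Sum>p\<in>?P - {id}. coeff (?t p) k)"
    by (rule sum.remove) (auto simp: permutes_id)
  also have "(\<Sum>p\<in>?P - {id}. coeff (?t p) k) = 0"
    using off_diag by (intro sum.neutral) auto
  finally show ?thesis
    by simp
qed

text \<open>
  Eigenvalues are listed with algebraic multiplicity, as the roots of the characteristic polynomial.
  Comparing the coefficient of degree \<open>n - 1\<close> in its factorization with the one given by the diagonal
  identifies their sum with the trace.
\<close>

lemma trace_eq_sum_eigenvalues:
  fixes M :: "complex ^ 'n ^ 'n"
  obtains \<mu> :: "nat \<Rightarrow> complex"
  where "\<And>k. k < CARD('n) \<Longrightarrow> \<mu> k \<in> eigenvalues M" and "trace M = (\<Sum>k<CARD('n). \<mu> k)"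
proof -
  let ?n = "CARD('n)"
  have lead: "coeff (charpoly M) ?n = 1"
    using coeff_prod_linear_factors(1)[of UNIV "\<lambda>i. M $ i $ i"] by (simp add: coeff_charpoly)
  have sub: "coeff (charpoly M) (?n - 1) = - trace M"
    using coeff_prod_linear_factors(2)[of UNIV "\<lambda>i. M $ i $ i"]
    by (simp add: coeff_charpoly trace_def)
  have "degree (charpoly M) \<le> ?n"
  proof (rule degree_le, intro allI impI)
    fix k assume "?n < k"
    moreover from this have "coeff (\<Prod>i\<in>UNIV. [:- (M $ i $ i), 1:]) k = 0"
      using degree_prod_linear_factors_le[of UNIV "\<lambda>i. M $ i $ i"] by (intro coeff_eq_0) simp
    ultimately show "coeff (charpoly M) k = 0"
      by (simp add: coeff_charpoly)
  qed
  then have deg: "degree (charpoly M) = ?n"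
    using lead by (metis le_antisym le_degree zero_neq_one)
  then have "charpoly M \<noteq> 0"
    using lead by auto
  then obtain E where E: "size E = ?n" "charpoly M = (\<Prod>x\<in>#E. [:- x, 1:])"
    using alg_closed_imp_factorization[of "charpoly M"] deg lead by auto
  obtain xs where xs: "mset xs = E"
    using ex_mset by blast
  then have len: "length xs = ?n"
    using E(1) by auto
  have fact: "charpoly M = (\<Prod>k<?n. [:- (xs ! k), 1:])"
    using E(2) len by (simp flip: xs mset_map add: prod_mset_prod_list prod.list_conv_set_nth
        atLeast0LessThan)
  show ?thesis
  proof
    fix k assume k: "k < ?n"
    have "det (mat (xs ! k) - M) = poly (charpoly M) (xs ! k)"
      by (simp add: poly_charpoly)
    also have "\<dots> = 0"
      using k by (auto simp: fact poly_prod)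
    finally have "det ((-1) *\<^sub>R M + mat (xs ! k)) = 0"
      by simp
    from eigenvalue_if_det_eq_0[OF this] show "xs ! k \<in> eigenvalues M"
      by simp
  next
    show "trace M = (\<Sum>k<?n. xs ! k)"
      using sub coeff_prod_linear_factors(2)[of "{..<?n}" "\<lambda>k. xs ! k"]
      by (simp add: fact lessThan_empty_iff)
  qed
qed

lemma mean_in_convex_hull_eigenvalues:
  fixes M :: "complex ^ 'n ^ 'n"
  shows "trace M / of_nat CARD('n) \<in> convex hull eigenvalues M"
proof -
  obtain \<mu> where \<mu>: "\<And>k. k < CARD('n) \<Longrightarrow> \<mu> k \<in> eigenvalues M"
    and tr: "trace M = (\<Sum>k<CARD('n). \<mu> k)"
    using trace_eq_sum_eigenvalues[of M] by blast
  have "(\<Sum>k<CARD('n). (1 / real CARD('n)) *\<^sub>R \<mu> k) \<in> convex hull eigenvalues M"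
    using \<mu> by (intro convex_sum) (auto intro: hull_inc)
  also have "(\<Sum>k<CARD('n). (1 / real CARD('n)) *\<^sub>R \<mu> k) = trace M / of_nat CARD('n)"
    by (simp add: tr scaleR_conv_of_real sum_divide_distrib)
  finally show ?thesis .
qed


section \<open>Contracting the spectrum to its mean\<close>

text \<open>
  A vanishing determinant at \<open>s < 1\<close> would give an eigenvalue \<open>\<mu>\<close> with \<open>(1 - s) \<mu> + s c = 0\<close>, where \<open>c\<close>
  is the mean. This exhibits \<open>0\<close> as a convex combination of two points of the hull.
\<close>

lemma det_contraction_nonzero:
  fixes M :: "complex ^ 'n ^ 'n"
  assumes hull: "0 \<notin> convex hull eigenvalues M" and s: "s \<in> {0..1}"
  shows "det ((1 - s) *\<^sub>R M + mat (of_real s * (trace M / of_nat CARD('n)))) \<noteq> 0"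
proof
  let ?c = "trace M / of_nat CARD('n)"
  assume det0: "det ((1 - s) *\<^sub>R M + mat (of_real s * ?c)) = 0"
  have c: "?c \<in> convex hull eigenvalues M"
    by (rule mean_in_convex_hull_eigenvalues)
  show False
  proof (cases "s = 1")
    case True
    then have "det (mat ?c :: complex ^ 'n ^ 'n) = 0"
      using det0 by simp
    then have "?c = 0"
      by (subst (asm) det_diagonal) (auto simp: mat_def)
    then show False using c hull by simp
  next
    case False
    define \<mu> where "\<mu> = - (of_real s * ?c) / of_real (1 - s)"
    have "\<mu> \<in> convex hull eigenvalues M"
      using eigenvalue_if_det_eq_0[OF det0] False by (auto simp: \<mu>_def intro: hull_inc)
    then have "(1 - s) *\<^sub>R \<mu> + s *\<^sub>R ?c \<in> convex hull eigenvalues M"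
      using c s by (intro convexD[OF convex_convex_hull]) auto
    moreover have "(1 - s) *\<^sub>R \<mu> + s *\<^sub>R ?c = 0"
    proof -
      have "complex_of_real (1 - s) * \<mu> = - (of_real s * ?c)"
        using False unfolding \<mu>_def by (subst times_divide_eq_right, subst nonzero_mult_div_cancel_left) auto
      then show ?thesis
        by (simp only: scaleR_conv_of_real left_minus)
    qed
    ultimately show False using hull by simp
  qed
qed

lemma wn_power:
  assumes "continuous_on {0..1} \<gamma>" "\<And>t. t \<in> {0..1} \<Longrightarrow> \<gamma> t \<noteq> 0" "\<gamma> 0 = \<gamma> 1"
  shows "wn (\<lambda>t. \<gamma> t ^ n) = int n * wn \<gamma>"
proof -
  obtain \<rho> s where lift: "polar_lift \<gamma> \<rho> s"
    using polar_lift_exists assms(1,2) by blast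
  have "polar_lift (\<lambda>t. \<gamma> t ^ n) (\<lambda>t. \<rho> t ^ n) (\<lambda>t. real n * s t)"
    unfolding polar_lift_def
  proof (intro conjI ballI)
    show "continuous_on {0..1} (\<lambda>t. \<rho> t ^ n)" "continuous_on {0..1} (\<lambda>t. real n * s t)"
      using lift by (auto simp: polar_lift_def intro: continuous_on_power continuous_on_mult_left)
    fix t :: real assume t: "t \<in> {0..1}"
    then show "\<rho> t ^ n > 0"
      using lift by (simp add: polar_lift_def)
    have "\<gamma> t = complex_of_real (\<rho> t) * exp (\<i> * complex_of_real (2 * pi * s t))"
      using lift t by (simp add: polar_lift_def)
    moreover have "exp (\<i> * complex_of_real (2 * pi * s t)) ^ n =
        exp (\<i> * complex_of_real (2 * pi * (real n * s t)))"
      by (simp add: mult_ac flip: exp_of_nat_mult)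
    ultimately show "\<gamma> t ^ n = complex_of_real (\<rho> t ^ n) *
        exp (\<i> * complex_of_real (2 * pi * (real n * s t)))"
      by (simp add: power_mult_distrib)
  qed
  then have "real_of_int (wn (\<lambda>t. \<gamma> t ^ n)) = real n * s 1 - real n * s 0"
    using assms by (intro wn_eq_lift) (auto intro!: continuous_intros)
  also have "\<dots> = real n * real_of_int (wn \<gamma>)"
    using wn_eq_lift[OF assms lift] by (simp add: right_diff_distrib)
  finally show ?thesis
    by (metis of_int_eq_iff of_int_mult of_int_of_nat_eq)
qed

section \<open>Spectra around the origin along a loop of matrices\<close>

lemma continuous_on_det:
  fixes M :: "'a::topological_space \<Rightarrow> 'b::{real_normed_field} ^ 'n ^ 'n"
  assumes "continuous_on S M"
  shows "continuous_on S (\<lambda>x. det (M x))"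
  unfolding det_def using assms
  by (intro continuous_on_sum continuous_on_mult continuous_on_const continuous_on_prod
      continuous_on_component)

theorem mainTheorem1:
  fixes A :: "real \<Rightarrow> complex ^ 'n ^ 'n"
  assumes "continuous_on {0..1} A"
    and "\<And>t. t \<in> {0..1} \<Longrightarrow> invertible (A t)"
    and "A 0 = A 1"
    and "\<not> int CARD('n) dvd wn_matrix A"
  shows "\<exists>\<phi>\<in>{0..1}. 0 \<in> convex hull eigenvalues (A \<phi>) \<and>
           convex hull eigenvalues (A \<phi>) \<subseteq> numerical_range (A \<phi>)"
proof -
  have "\<exists>\<phi>\<in>{0..1}. 0 \<in> convex hull eigenvalues (A \<phi>)"
  proof (rule ccontr)
    assume "\<not> ?thesis"
    then have hull: "0 \<notin> convex hull eigenvalues (A t)" if "t \<in> {0..1}" for t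
      using that by blast
    define c where "c t = trace (A t) / of_nat CARD('n)" for t
    define H where "H = (\<lambda>(s, t). det ((1 - s) *\<^sub>R A t + mat (of_real s * c t)))"
    have H_nz: "H (s, t) \<noteq> 0" if "s \<in> {0..1}" "t \<in> {0..1}" for s t
      unfolding H_def c_def using det_contraction_nonzero[OF hull] that by simp
    have H0: "H (0, t) = det (A t)" for t
      by (simp add: H_def)
    have H1: "H (1, t) = c t ^ CARD('n)" for t
      by (simp add: H_def) (subst det_diagonal, auto simp: mat_def)
    have cont_c: "continuous_on {0..1} c"
      unfolding c_def trace_def using assms(1) by (intro continuous_intros) auto
    have cont_H: "continuous_on ({0..1} \<times> {0..1}) H"
    proof -
      have A2: "continuous_on ({0..1} \<times> {0..1}) (\<lambda>x::real \<times> real. A (snd x))"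
        by (rule continuous_on_compose2[OF assms(1)]) (auto intro: continuous_intros)
      have c2: "continuous_on ({0..1} \<times> {0..1}) (\<lambda>x::real \<times> real. c (snd x))"
        by (rule continuous_on_compose2[OF cont_c]) (auto intro: continuous_intros)
      have "continuous_on ({0..1} \<times> {0..1})
          (\<lambda>x::real \<times> real. mat (of_real (fst x) * c (snd x)) :: complex ^ 'n ^ 'n)"
        unfolding mat_def
      proof (intro continuous_on_vec_lambda)
        fix i j :: 'n
        show "continuous_on ({0..1} \<times> {0..1})
            (\<lambda>x::real \<times> real. if i = j then of_real (fst x) * c (snd x) else 0)"
          using c2 by (cases "i = j") (auto intro!: continuous_intros)
      qed
      then show ?thesis
        unfolding H_def case_prod_unfold using A2
        by (intro continuous_on_det continuous_intros)
    qed
    have "homotopic_loops (- {0}) (\<lambda>t. det (A t)) (\<lambda>t. c t ^ CARD('n))"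
      unfolding homotopic_loops
    proof (intro exI conjI ballI)
      show "H \<in> {0..1} \<times> {0..1} \<rightarrow> - {0}"
        using H_nz by auto
      show "pathfinish (H \<circ> Pair s) = pathstart (H \<circ> Pair s)" for s
        using assms(3) by (simp add: pathfinish_def pathstart_def H_def c_def)
    qed (use cont_H H0 H1 in auto)
    then have "winding_number (\<lambda>t. det (A t)) 0 = winding_number (\<lambda>t. c t ^ CARD('n)) 0"
      by (rule winding_number_homotopic_loops)
    moreover have loop_det: "complex_of_int (wn (\<lambda>t. det (A t))) = winding_number (\<lambda>t. det (A t)) 0"
      using assms(1,2,3)
      by (intro wn_eq_winding_number continuous_on_det) (auto simp: invertible_det_nz)
    moreover have c_nz: "c t \<noteq> 0" if "t \<in> {0..1}" for t
      using H_nz[of 1 t] that by (auto simp: H1)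
    moreover have c_loop: "c 0 = c 1"
      using assms(3) by (simp add: c_def)
    moreover have "complex_of_int (wn (\<lambda>t. c t ^ CARD('n))) = winding_number (\<lambda>t. c t ^ CARD('n)) 0"
      using cont_c c_nz c_loop by (intro wn_eq_winding_number) (auto intro: continuous_intros)
    ultimately have "wn_matrix A = wn (\<lambda>t. c t ^ CARD('n))"
      unfolding wn_matrix_def by (metis of_int_eq_iff)
    also have "\<dots> = int CARD('n) * wn c"
      using cont_c c_nz c_loop by (rule wn_power)
    finally show False
      using assms(4) by simp
  qed
  then show ?thesis
    using convex_hull_eigenvalues_subset_numerical_range by blast
qed

end
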